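(* Every strongly $\Delta$-clean ring is strongly clean.
   Context: Rings are associative with identity, not necessarily commutative. $U(R)$ is the group of units of $R$. Define $\Delta(R)=\{x\in R \mid 1-xu\in U(R)\text{ for all }u\in U(R)\}$. A ring $R$ is strongly $\Delta$-clean if every $a\in R$ can be written $a=e+d$ with $e^2=e\in R$, $d\in\Delta(R)$ and $ed=de$. A ring $R$ is strongly clean if every $a\in R$ can be written $a=e+u$ with $e^2=e\in R$, $u\in U(R)$ and $eu=ue$. *)

theory Defs
  imports "HOL-Algebra.Ring"
begin

definition Delta :: "('a, 'm) ring_scheme \<Rightarrow> 'a set" where
  "Delta R = {x \<in> carrier R. \<forall>u \<in> Units R. \<one>\<^bsub>R\<^esub> \<ominus>\<^bsub>R\<^esub> x \<otimes>\<^bsub>R\<^esub> u \<in> Units R}"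

definition strongly_Delta_clean :: "('a, 'm) ring_scheme \<Rightarrow> bool" where
  "strongly_Delta_clean R \<longleftrightarrow>
     (\<forall>a \<in> carrier R. \<exists>e \<in> carrier R. \<exists>d \<in> Delta R.
        a = e \<oplus>\<^bsub>R\<^esub> d \<and> e \<otimes>\<^bsub>R\<^esub> e = e \<and> e \<otimes>\<^bsub>R\<^esub> d = d \<otimes>\<^bsub>R\<^esub> e)"

definition strongly_clean :: "('a, 'm) ring_scheme \<Rightarrow> bool" where
  "strongly_clean R \<longleftrightarrow>
     (\<forall>a \<in> carrier R. \<exists>e \<in> carrier R. \<exists>u \<in> Units R.
        a = e \<oplus>\<^bsub>R\<^esub> u \<and> e \<otimes>\<^bsub>R\<^esub> e = e \<and> e \<otimes>\<^bsub>R\<^esub> u = u \<otimes>\<^bsub>R\<^esub> e)"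

end

theory Submission
  imports Defs
begin

text \<open>If \<open>a = e + d\<close> with \<open>e\<close> idempotent, \<open>d \<in> \<Delta>(R)\<close> and \<open>ed = de\<close>, then
  \<open>a = (1 - e) + (v + d)\<close> where \<open>v = 2e - 1\<close> satisfies \<open>v\<^sup>2 = 1\<close>; hence
  \<open>v + d = (1 - d(-v))v\<close> is a unit, because \<open>-v\<close> is one.\<close>

lemma (in ring) Delta_add_unit:
  assumes "d \<in> Delta R" "v \<in> carrier R" "v \<otimes> v = \<one>"
  shows "v \<oplus> d \<in> Units R"
proof -
  have d: "d \<in> carrier R"
    using assms(1) by (simp add: Delta_def)
  have v: "v \<in> Units R"
    using assms(2,3) by (auto simp: Units_def)
  have "\<ominus> v \<otimes> \<ominus> v = \<one>"
    using assms(2,3) by (simp add: l_minus r_minus)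
  then have mv: "\<ominus> v \<in> Units R"
    using assms(2) a_inv_closed[of v] unfolding Units_def by blast
  have "\<one> \<ominus> d \<otimes> (\<ominus> v) \<in> Units R"
    using assms(1) mv by (simp add: Delta_def)
  then have "(\<one> \<ominus> d \<otimes> (\<ominus> v)) \<otimes> v \<in> Units R"
    using v by (rule Units_m_closed)
  \<comment> \<open>The two signs cancel, leaving (1 + dv)v = v + d(vv), and \<open>v\<close>
    squares to one.\<close>
  moreover have "(\<one> \<ominus> d \<otimes> (\<ominus> v)) \<otimes> v = v \<oplus> d"
    using d assms(2,3) by (simp add: minus_eq r_minus l_distr m_assoc)
  ultimately show ?thesis by simp
qed

theorem lemma2p4:
  fixes R :: "('a, 'm) ring_scheme"
  assumes "ring R"
    and "strongly_Delta_clean R"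
  shows "strongly_clean R"
proof -
  interpret ring R by fact
  show ?thesis
    unfolding strongly_clean_def
  proof
    fix a assume "a \<in> carrier R"
    then obtain e d where e: "e \<in> carrier R" and dD: "d \<in> Delta R"
      and a: "a = e \<oplus>\<^bsub>R\<^esub> d" and ee: "e \<otimes>\<^bsub>R\<^esub> e = e"
      and ed: "e \<otimes>\<^bsub>R\<^esub> d = d \<otimes>\<^bsub>R\<^esub> e"
      using assms(2) unfolding strongly_Delta_clean_def by blast
    have d: "d \<in> carrier R"
      using dD by (simp add: Delta_def)
    \<comment> \<open>\<open>f\<close> is to be the idempotent of the clean decomposition. Writing
      2e - 1 as the difference of \<open>e\<close> and \<open>f\<close> lets products with
      \<open>v\<close> be computed from the orthogonality of \<open>e\<close> and
      \<open>f\<close>.\<close>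
    define f where "f = \<one>\<^bsub>R\<^esub> \<ominus>\<^bsub>R\<^esub> e"
    define v where "v = e \<ominus>\<^bsub>R\<^esub> f"
    have f: "f \<in> carrier R" and v: "v \<in> carrier R"
      using e by (simp_all add: f_def v_def)
    have ef: "e \<otimes>\<^bsub>R\<^esub> f = \<zero>\<^bsub>R\<^esub>" and fe: "f \<otimes>\<^bsub>R\<^esub> e = \<zero>\<^bsub>R\<^esub>"
      using e ee by (simp_all add: f_def minus_eq l_distr r_distr l_minus r_minus r_neg)
    have fd: "f \<otimes>\<^bsub>R\<^esub> d = d \<otimes>\<^bsub>R\<^esub> f"
      using e d ed by (simp add: f_def minus_eq l_distr r_distr l_minus r_minus)
    have e_f: "e \<oplus>\<^bsub>R\<^esub> f = \<one>\<^bsub>R\<^esub>"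
      using e by (simp add: f_def minus_eq a_lcomm[of e "\<one>\<^bsub>R\<^esub>"] r_neg)
    \<comment> \<open>Multiplying e + f = 1 by \<open>f\<close> on the left kills the term fe, so
      idempotence of \<open>f\<close> comes out without expanding the square of 1 - e.\<close>
    have "f \<otimes>\<^bsub>R\<^esub> (e \<oplus>\<^bsub>R\<^esub> f) = f"
      using e_f f by simp
    then have ff: "f \<otimes>\<^bsub>R\<^esub> f = f"
      using e f fe by (simp add: r_distr)
    \<comment> \<open>The cross terms vanish by orthogonality; what remains is ee + ff = e + f =
      1.\<close>
    have vv: "v \<otimes>\<^bsub>R\<^esub> v = \<one>\<^bsub>R\<^esub>"
      using e f ee ef fe ff e_f
      by (simp add: v_def minus_eq l_distr r_distr l_minus r_minus)
    \<comment> \<open>By orthogonality both sides reduce to -(ff).\<close>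
    have fv: "f \<otimes>\<^bsub>R\<^esub> v = v \<otimes>\<^bsub>R\<^esub> f"
      using e f ef fe by (simp add: v_def minus_eq l_distr r_distr l_minus r_minus)
    have "a = f \<oplus>\<^bsub>R\<^esub> (v \<oplus>\<^bsub>R\<^esub> d)"
      using e f d by (simp add: a v_def minus_eq a_ac r_neg r_neg1 r_neg2)
    moreover have "f \<otimes>\<^bsub>R\<^esub> (v \<oplus>\<^bsub>R\<^esub> d) = (v \<oplus>\<^bsub>R\<^esub> d) \<otimes>\<^bsub>R\<^esub> f"
      using f v d fv fd by (simp add: l_distr r_distr)
    \<comment> \<open>The witnesses are \<open>f\<close> and v + d; the bound \<open>e\<close> is
      not the idempotent obtained above.\<close>
    ultimately show "\<exists>e\<in>carrier R. \<exists>u\<in>Units R.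
        a = e \<oplus>\<^bsub>R\<^esub> u \<and> e \<otimes>\<^bsub>R\<^esub> e = e \<and> e \<otimes>\<^bsub>R\<^esub> u = u \<otimes>\<^bsub>R\<^esub> e"
      using f ff Delta_add_unit[OF dD v vv] by blast
  qed
qed

end
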